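(* Let $1\le k\le N-1$ satisfy $\phi^{k-1}-\phi^k>\phi^k-\phi^{k+1}$, let $F\in\tilde{\mathcal F}^k$, let $\mathcal U$ be an unlabeled atom and $\mathcal M$ a labeled atom of $\mathfrak A_k$. If $F$ contains an arc leaving $\mathcal U$ whose head lies in $\mathcal M$, then this arc is the only arc of $F$ leaving $\mathcal U$.
   Context: $V$ is a digraph with vertex set $\mathcal N$, $|\mathcal N|=N$, real arc weights, having at least one spanning tree. An (entering) forest is a digraph in which every vertex has at most one outgoing arc and there is no directed cycle; its weakly connected components are trees, each with a root (the unique vertex with no outgoing arc). $\mathcal F^k$ is the set of spanning forests of $V$ with exactly $k$ trees; $\Upsilon^F$ is total arc weight; $\phi^k=\min_{\mathcal F^k}\Upsilon^F$, $\phi^0=\infty$; $\tilde{\mathcal F}^k$ the forests in $\mathcal F^k$ of weight $\phi^k$. $\mathfrak A_k$ is the algebra of subsets of $\mathcal N$ generated by the vertex sets of trees of forests in $\tilde{\mathcal F}^k$; atoms are its minimal nonempty elements; an atom is labeled if it contains a root of some forest of $\tilde{\mathcal F}^k$, unlabeled otherwise. An arc leaves $\mathcal U$ if its tail is in $\mathcal U$ and its head is not. *)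

theory Defs
  imports "HOL-Library.Extended_Real"
begin

text \<open>A weighted digraph: finite vertex set V, arc set E \<subseteq> V \<times> V, arc weights w.
  An arc is a pair (tail, head).\<close>

definition is_forest :: "('a \<times> 'a) set \<Rightarrow> bool" where
  "is_forest F \<longleftrightarrow> (\<forall>u v v'. (u,v) \<in> F \<and> (u,v') \<in> F \<longrightarrow> v = v') \<and> acyclic F"

definition trees :: "'a set \<Rightarrow> ('a \<times> 'a) set \<Rightarrow> 'a set set" where
  "trees V F = V // {(x,y). x \<in> V \<and> y \<in> V \<and> (x,y) \<in> (F \<union> F\<inverse>)\<^sup>*}"

definition roots :: "'a set \<Rightarrow> ('a \<times> 'a) set \<Rightarrow> 'a set" where
  "roots V F = {x \<in> V. \<forall>y. (x,y) \<notin> F}"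

definition sforests :: "'a set \<Rightarrow> ('a \<times> 'a) set \<Rightarrow> nat \<Rightarrow> ('a \<times> 'a) set set" where
  "sforests V E k = {F. F \<subseteq> E \<and> is_forest F \<and> card (trees V F) = k}"

definition weight :: "('a \<Rightarrow> 'a \<Rightarrow> real) \<Rightarrow> ('a \<times> 'a) set \<Rightarrow> real" where
  "weight w F = (\<Sum>(u,v)\<in>F. w u v)"

definition phi :: "'a set \<Rightarrow> ('a \<times> 'a) set \<Rightarrow> ('a \<Rightarrow> 'a \<Rightarrow> real) \<Rightarrow> nat \<Rightarrow> ereal" where
  "phi V E w k = (if k = 0 then \<infinity> else (INF F \<in> sforests V E k. ereal (weight w F)))"

definition opt_forests :: "'a set \<Rightarrow> ('a \<times> 'a) set \<Rightarrow> ('a \<Rightarrow> 'a \<Rightarrow> real) \<Rightarrow> nat \<Rightarrow> ('a \<times> 'a) set set" where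
  "opt_forests V E w k = {F \<in> sforests V E k. ereal (weight w F) = phi V E w k}"

inductive_set gen_algebra :: "'a set \<Rightarrow> 'a set set \<Rightarrow> 'a set set" for V G where
  gen: "A \<in> G \<Longrightarrow> A \<in> gen_algebra V G"
| empty: "{} \<in> gen_algebra V G"
| compl: "A \<in> gen_algebra V G \<Longrightarrow> V - A \<in> gen_algebra V G"
| union: "A \<in> gen_algebra V G \<Longrightarrow> B \<in> gen_algebra V G \<Longrightarrow> A \<union> B \<in> gen_algebra V G"

definition algebra_k :: "'a set \<Rightarrow> ('a \<times> 'a) set \<Rightarrow> ('a \<Rightarrow> 'a \<Rightarrow> real) \<Rightarrow> nat \<Rightarrow> 'a set set" where
  "algebra_k V E w k = gen_algebra V (\<Union>F \<in> opt_forests V E w k. trees V F)"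

definition atoms :: "'a set set \<Rightarrow> 'a set set" where
  "atoms \<A> = {A \<in> \<A>. A \<noteq> {} \<and> (\<forall>B \<in> \<A>. B \<noteq> {} \<and> B \<subseteq> A \<longrightarrow> B = A)}"

definition labeled :: "'a set \<Rightarrow> ('a \<times> 'a) set \<Rightarrow> ('a \<Rightarrow> 'a \<Rightarrow> real) \<Rightarrow> nat \<Rightarrow> 'a set \<Rightarrow> bool" where
  "labeled V E w k A \<longleftrightarrow> (\<exists>F \<in> opt_forests V E w k. A \<inter> roots V F \<noteq> {})"

definition leaves :: "'a set \<Rightarrow> 'a \<times> 'a \<Rightarrow> bool" where
  "leaves U a \<longleftrightarrow> fst a \<in> U \<and> snd a \<notin> U"

end

theory Submission
  imports Defs
begin

text \<open>
  Exchanging the out-arcs of a vertex set between two minimal forests preserves the total weight.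
  By strict convexity, if both results are forests, then neither has \<open>k - 1\<close> trees, and if they
  have \<open>k\<close> trees they are again minimal. Exchanging along a tree of one forest is always possible;
  hence every tree of a minimal forest contains exactly one root of every other minimal forest, and
  roots that share a tree of one minimal forest are never separated by another.

  Suppose a minimal forest \<open>F\<close> has arcs \<open>u \<rightarrow> m\<close> and \<open>v \<rightarrow> n\<close> leaving \<open>\<U>\<close>, with \<open>m \<in> \<M>\<close>. A minimal
  forest \<open>H\<close> separating \<open>n\<close> from \<open>\<U>\<close> must join \<open>n\<close> to \<open>\<M>\<close>, since otherwise giving the \<open>H\<close>-tree of \<open>n\<close>
  its \<open>H\<close>-arcs in \<open>F\<close> would separate \<open>v\<close> from \<open>u\<close>. After two exchanges along trees, \<open>F\<close> and \<open>H\<close> differ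
  only on a set \<open>W\<close> containing \<open>u\<close> and \<open>v\<close>, from which \<open>F\<close> leads to \<open>\<M>\<close> and \<open>H\<close> leads elsewhere.
  The argument behind Edmonds' disjoint branchings theorem redistributes the arcs on \<open>W\<close> so that
  both results are forests and one of them separates \<open>u\<close> from \<open>v\<close>, although both lie in the atom \<open>\<U>\<close>.
\<close>

section \<open>Branchings out of a vertex set and the redistribution of their arcs\<close>

definition graph_on :: "'a set \<Rightarrow> ('a \<Rightarrow> 'a) \<Rightarrow> ('a \<times> 'a) set" where
  "graph_on X f = {(x, f x) |x. x \<in> X}"

text \<open>The complement of \<open>W\<close> acts as the contracted root of Edmonds' theorem: if
  every vertex of \<open>W\<close> escapes, \<open>A\<close> contains a branching directed out of
  \<open>W\<close>.\<close>

definition escapes :: "'a set \<Rightarrow> ('a \<times> 'a) set \<Rightarrow> 'a \<Rightarrow> bool" where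
  "escapes W A x \<longleftrightarrow> (\<exists>y. y \<notin> W \<and> (x, y) \<in> A\<^sup>*)"

lemma graph_on_iff [simp]: "(x, y) \<in> graph_on X f \<longleftrightarrow> x \<in> X \<and> y = f x"
  by (auto simp: graph_on_def)

lemma escapes_outside: "x \<notin> W \<Longrightarrow> escapes W A x"
  by (auto simp: escapes_def)

lemma escapes_mono: "escapes W A x \<Longrightarrow> A \<subseteq> B \<Longrightarrow> escapes W B x"
  unfolding escapes_def using rtrancl_mono by blast

lemma escapes_step: "(x, y) \<in> A \<Longrightarrow> escapes W A y \<Longrightarrow> escapes W A x"
  unfolding escapes_def by (meson converse_rtrancl_into_rtrancl)

lemma escapes_rtrancl: "(x, y) \<in> A\<^sup>* \<Longrightarrow> escapes W A y \<Longrightarrow> escapes W A x"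
  unfolding escapes_def by (meson rtrancl_trans)

lemma escapes_induct [consumes 1, case_names outside step]:
  assumes "escapes W A x"
    and "\<And>x. x \<notin> W \<Longrightarrow> P x"
    and "\<And>x y. x \<in> W \<Longrightarrow> (x, y) \<in> A \<Longrightarrow> escapes W A y \<Longrightarrow> P y \<Longrightarrow> P x"
  shows "P x"
proof -
  obtain z where z: "z \<notin> W" and "(x, z) \<in> A\<^sup>*" using assms(1) by (auto simp: escapes_def)
  from this(2) show ?thesis
  proof (induction rule: converse_rtrancl_induct)
    case base
    then show ?case using assms(2) z by blast
  next
    case (step x y)
    then show ?case using assms(2,3) z by (metis escapes_def)
  qed
qed

lemma escapes_leaves:
  assumes "escapes W A x" and "x \<in> Y" and "Y \<subseteq> W"
  shows "\<exists>y z. y \<in> Y \<and> z \<notin> Y \<and> (y, z) \<in> A"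
  using assms by (induction rule: escapes_induct) blast+

definition without :: "('a \<times> 'a) set \<Rightarrow> 'a \<Rightarrow> ('a \<times> 'a) set" where
  "without B w = {(x, y) \<in> B. x \<noteq> w}"

text \<open>Follow the walk in \<open>B\<close> until it first meets \<open>w\<close>, then continue
  with the walk of \<open>w\<close> in \<open>C\<close>.\<close>

lemma escapes_via:
  assumes "escapes W B x" and "without B w \<subseteq> C" and "escapes W C w"
  shows "escapes W C x"
  using assms
proof (induction rule: escapes_induct)
  case (outside x)
  then show ?case by (simp add: escapes_outside)
next
  case (step x y)
  then show ?case by (cases "x = w") (auto simp: without_def intro!: escapes_step[of x y C])
qed

text \<open>
  One step of Lovasz's proof of Edmonds' disjoint branchings theorem. An arc may be taken out of
  \<open>B\<close> unless its tail \<open>w\<close> then cuts off the head of the other arc at \<open>w\<close>; a \<open>w\<close> that cuts off as few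
  vertices as possible cannot be an obstruction.
\<close>

lemma removable_arc:
  fixes f h :: "'a \<Rightarrow> 'a"
  assumes "finite W" and "R \<subset> W"
    and f: "\<And>x. x \<in> W \<Longrightarrow> escapes W (graph_on W f) x"
    and h: "\<And>x. x \<in> W \<Longrightarrow> escapes W (graph_on W h) x"
    and B: "\<And>x. x \<in> W \<Longrightarrow> escapes W B x"
    and BR: "\<And>x y. x \<in> W - R \<Longrightarrow> (x, y) \<in> B \<longleftrightarrow> y = f x \<or> y = h x"
  shows "\<exists>w p q. w \<in> W - R \<and> (p = f w \<and> q = h w \<or> p = h w \<and> q = f w) \<and> (p \<in> R \<or> p \<notin> W) \<and>
    escapes W (without B w) q"
proof (rule ccontr)
  assume neg: "\<not> ?thesis"
  \<comment> \<open>\<open>p\<close> is a head in \<open>R\<close> or outside \<open>W\<close>; the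
    other head \<open>q\<close> should still escape once \<open>w\<close> has lost its arcs.
    \<open>Z w\<close> collects what \<open>w\<close> cuts off.\<close>
  define cand where "cand w p q \<longleftrightarrow> w \<in> W - R \<and> (p = f w \<and> q = h w \<or> p = h w \<and> q = f w) \<and>
    (p \<in> R \<or> p \<notin> W)" for w p q
  define Z where "Z w = {x \<in> W. \<not> escapes W (without B w) x}" for w
  have bad: "q \<in> Z w" if "cand w p q" for w p q
    using that neg escapes_outside[of q W] unfolding cand_def Z_def by blast
  obtain x where "x \<in> W - R" using \<open>R \<subset> W\<close> by blast
  then obtain y where "y \<in> W - R" "f y \<notin> W - R"
    using escapes_leaves[of W "graph_on W f" x "W - R"] f by auto
  then have "cand y (f y) (h y)" by (auto simp: cand_def)
  then have ex: "\<exists>w. \<exists>p q. cand w p q" by blast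
  define w where "w = (ARG_MIN (\<lambda>w. card (Z w)) w. \<exists>p q. cand w p q)"
  have "\<exists>p q. cand w p q" and min: "card (Z w) \<le> card (Z y)" if "\<exists>p q. cand y p q" for y
    using arg_min_nat_lemma[of "\<lambda>w. \<exists>p q. cand w p q" _ "\<lambda>w. card (Z w)"] ex that
    unfolding w_def by blast+
  then obtain p q where c: "cand w p q" using ex by blast
  have wW: "w \<in> W" "w \<notin> R" using c by (auto simp: cand_def)
  have fin: "finite (Z x)" for x using \<open>finite W\<close> by (simp add: Z_def)
  have wZ: "w \<in> Z w"
  proof -
    have "\<not> escapes W (without B w) w"
    proof
      assume "escapes W (without B w) w"
      then obtain z where "z \<notin> W" "(w, z) \<in> (without B w)\<^sup>*" by (auto simp: escapes_def)
      then show False using wW by (auto simp: without_def elim: converse_rtranclE)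
    qed
    then show ?thesis using wW by (simp add: Z_def)
  qed
  have closed: "z \<in> Z w" if "y \<in> Z w" "y \<noteq> w" "(y, z) \<in> B" for y z
  proof -
    have "(y, z) \<in> without B w" using that by (simp add: without_def)
    then have "\<not> escapes W (without B w) z"
      using that(1) escapes_step[of y z "without B w" W] by (auto simp: Z_def)
    then show ?thesis using escapes_outside[of z W] by (auto simp: Z_def)
  qed
  have qZ: "q \<in> Z w" by (rule bad[OF c])
  \<comment> \<open>\<open>B\<close> must lead out of \<open>Z w\<close>; by \<open>closed\<close>
    this happens only at \<open>w\<close>, and not through \<open>q\<close>.\<close>
  have pZ: "p \<notin> Z w"
  proof
    assume "p \<in> Z w"
    obtain y z where yz: "y \<in> Z w" "z \<notin> Z w" "(y, z) \<in> B"
      using escapes_leaves[OF B[OF wW(1)] wZ] by (auto simp: Z_def)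
    then have "y = w" using closed by blast
    then have "z = p \<or> z = q" using yz c BR[of w z] by (auto simp: cand_def)
    then show False using yz qZ \<open>p \<in> Z w\<close> by blast
  qed
  have qR: "q \<notin> R"
  proof
    assume "q \<in> R"
    then have "cand w q p" using c by (auto simp: cand_def)
    then show False using bad pZ by blast
  qed
  \<comment> \<open>Take the map that sends \<open>w\<close> to \<open>q\<close>. One of its arcs
    leaves \<open>Z w - R\<close>, at some \<open>y\<close> and necessarily into \<open>R\<close>,
    so \<open>y\<close> is a candidate too.\<close>
  obtain c' where c': "c' = f \<or> c' = h" "c' w = q" using c by (auto simp: cand_def)
  have "escapes W (graph_on W c') w" using c' f h wW by blast
  then obtain y where y: "y \<in> Z w - R" "c' y \<notin> Z w - R"
    using escapes_leaves[of W "graph_on W c'" w "Z w - R"] wZ wW by (auto simp: Z_def)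
  have yw: "y \<noteq> w" using y qZ qR c' by auto
  have yW: "y \<in> W - R" using y by (auto simp: Z_def)
  have "(y, c' y) \<in> B" using BR[OF yW] c' by auto
  then have "c' y \<in> R" using closed[of y "c' y"] y yw by auto
  then have "\<exists>p q. cand y p q" using yW c' unfolding cand_def by blast
  then have le: "card (Z w) \<le> card (Z y)" by (rule min)
  have ny: "\<not> escapes W (without B w) y" using y by (simp add: Z_def)
  \<comment> \<open>A walk that escapes without the arcs of \<open>w\<close> cannot meet
    \<open>y\<close>, which \<open>w\<close> cuts off.\<close>
  have avoid: "escapes W (without B y) x" if "escapes W (without B w) x" for x
    using that
  proof (induction rule: escapes_induct)
    case (outside x)
    then show ?case by (simp add: escapes_outside)
  next
    case (step x z)
    then have "x \<noteq> y" using ny escapes_step by metis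
    then show ?case using step escapes_step[of x z "without B y" W] by (auto simp: without_def)
  qed
  have "Z y \<subseteq> Z w" using avoid by (auto simp: Z_def)
  \<comment> \<open>\<open>w\<close> still escapes through \<open>p\<close> when \<open>y\<close>
    loses its arcs; so \<open>y\<close> cuts off fewer vertices, against the choice of
    \<open>w\<close>.\<close>
  moreover have "w \<notin> Z y"
  proof -
    have "escapes W (without B w) p" using pZ escapes_outside[of p W] by (auto simp: Z_def)
    then have "escapes W (without B y) p" by (rule avoid)
    moreover have "(w, p) \<in> without B y" using BR[of w p] c yw by (auto simp: without_def cand_def)
    ultimately show ?thesis using escapes_step[of w p "without B y" W] by (simp add: Z_def)
  qed
  ultimately have "Z y \<subset> Z w" using wZ by blast
  then show False using psubset_card_mono[OF fin] le by (meson leD)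
qed

text \<open>\<open>R\<close> holds the decided vertices: the first branching uses \<open>h\<close>
  on \<open>X\<close> and \<open>f\<close> on \<open>R - X\<close>; the second keeps the opposite
  arcs on \<open>R\<close> and still has both arcs elsewhere. Deciding one vertex at a time by
  \<open>removable_arc\<close> preserves both invariants until \<open>R = W\<close>.\<close>

lemma branching_split_extend:
  fixes f h :: "'a \<Rightarrow> 'a"
  assumes "finite W" and "R \<subseteq> W" and "X \<subseteq> R"
    and f: "\<And>x. x \<in> W \<Longrightarrow> escapes W (graph_on W f) x"
    and h: "\<And>x. x \<in> W \<Longrightarrow> escapes W (graph_on W h) x"
    and R: "\<And>x. x \<in> R \<Longrightarrow> escapes W (graph_on X h \<union> graph_on (R - X) f) x"
    and B: "\<And>x. x \<in> W \<Longrightarrow> escapes W (graph_on (W - R \<union> X) f \<union> graph_on (W - X) h) x"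
  shows "\<exists>X'. X' \<subseteq> W \<and> X' \<inter> R = X \<and>
    (\<forall>x\<in>W. escapes W (graph_on X' h \<union> graph_on (W - X') f) x) \<and>
    (\<forall>x\<in>W. escapes W (graph_on X' f \<union> graph_on (W - X') h) x)"
  using assms(2,3) R B
proof (induction "card (W - R)" arbitrary: R X rule: less_induct)
  case less
  show ?case
  proof (cases "R = W")
    case True
    then show ?thesis using less.prems by (intro exI[of _ X]) auto
  next
    case False
    define B where "B = graph_on (W - R \<union> X) f \<union> graph_on (W - X) h"
    have "R \<subset> W" using False less.prems by blast
    moreover have "\<And>x. x \<in> W \<Longrightarrow> escapes W B x" using less.prems(4) by (simp add: B_def)
    moreover have "\<And>x y. x \<in> W - R \<Longrightarrow> (x, y) \<in> B \<longleftrightarrow> y = f x \<or> y = h x"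
      using less.prems by (auto simp: B_def)
    ultimately obtain w p q where w: "w \<in> W - R" "p = f w \<and> q = h w \<or> p = h w \<and> q = f w"
        "p \<in> R \<or> p \<notin> W" "escapes W (without B w) q"
      using removable_arc[OF \<open>finite W\<close> _ f h] by metis
    define R' where "R' = insert w R"
    define X' where "X' = (if p = f w \<and> q = h w then X else insert w X)"
    have lt: "card (W - R') < card (W - R)"
      using w \<open>finite W\<close> by (intro psubset_card_mono) (auto simp: R'_def)
    have sub: "R' \<subseteq> W" "X' \<subseteq> R'" using w less.prems by (auto simp: R'_def X'_def)
    let ?G = "graph_on X' h \<union> graph_on (R' - X') f"
    let ?B = "graph_on (W - R' \<union> X') f \<union> graph_on (W - X') h"
    have GG: "graph_on X h \<union> graph_on (R - X) f \<subseteq> ?G"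
      using w by (auto simp: graph_on_def R'_def X'_def)
    have wp: "(w, p) \<in> ?G"
      using w less.prems(2) by (auto simp: R'_def X'_def)
    have old: "escapes W ?G x" if "x \<in> R" for x
      using escapes_mono[OF less.prems(3)[OF that] GG] .
    have "escapes W ?G p" using w(3) old escapes_outside by metis
    then have G: "escapes W ?G x" if "x \<in> R'" for x
      using that old escapes_step[OF wp] by (auto simp: R'_def)
    have BB: "without B w \<subseteq> ?B"
      using w less.prems(2) by (auto simp: B_def without_def graph_on_def R'_def X'_def)
    have wq: "(w, q) \<in> ?B"
      using w less.prems(2) by (auto simp: R'_def X'_def)
    \<comment> \<open>Losing the arc to \<open>p\<close> does no harm: \<open>w\<close> escapes
      through \<open>q\<close>, and every walk through \<open>w\<close> can be rerouted
      there.\<close>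
    have "escapes W ?B w" using escapes_step[OF wq] escapes_mono[OF w(4) BB] by blast
    then have B': "escapes W ?B x" if "x \<in> W" for x
      using escapes_via[of W B x w ?B] BB less.prems(4)[OF that] by (simp add: B_def)
    obtain X'' where X'': "X'' \<subseteq> W" "X'' \<inter> R' = X'"
        "\<forall>x\<in>W. escapes W (graph_on X'' h \<union> graph_on (W - X'') f) x"
        "\<forall>x\<in>W. escapes W (graph_on X'' f \<union> graph_on (W - X'') h) x"
      using less.hyps[OF lt sub G B'] by blast
    have "X' \<inter> R = X" using w less.prems(2) by (auto simp: X'_def)
    then have "X'' \<inter> R = X" using X''(2) by (auto simp: R'_def)
    then show ?thesis using X'' by blast
  qed
qed

text \<open>With unique out-arcs, a cycle through \<open>x\<close> would contain the walk by which
  \<open>x\<close> escapes, hence a vertex outside \<open>W\<close>, where no arc starts.\<close>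

lemma escapes_acyclic:
  assumes "\<And>x. x \<in> W \<Longrightarrow> escapes W A x" and "single_valued A" and "Domain A \<subseteq> W"
  shows "acyclic A"
proof -
  have "(x, x) \<notin> A\<^sup>+" if "escapes W A x" for x
    using that
  proof (induction rule: escapes_induct)
    case (outside x)
    then show ?case using assms(3) by (meson DomainI subsetD tranclD)
  next
    case (step x y)
    show ?case
    proof
      assume "(x, x) \<in> A\<^sup>+"
      then obtain z where "(x, z) \<in> A" "(z, x) \<in> A\<^sup>*" by (meson tranclD)
      moreover have "z = y" using \<open>single_valued A\<close> step calculation by (meson single_valuedD)
      ultimately have "(y, y) \<in> A\<^sup>+" using step by (meson rtrancl_into_trancl1)
      then show False using step by blast
    qed
  qed
  moreover have "(x, x) \<notin> A\<^sup>+" if "x \<notin> W" for x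
    using that assms(3) by (meson DomainI subsetD tranclD)
  ultimately show ?thesis using assms(1) by (auto simp: acyclic_def)
qed

lemma single_valued_graph_on: "single_valued (graph_on W f)"
  by (auto simp: single_valued_def)

definition orbit :: "'a set \<Rightarrow> ('a \<Rightarrow> 'a) \<Rightarrow> 'a \<Rightarrow> 'a set" where
  "orbit W h v = {x \<in> W. (v, x) \<in> (graph_on W h)\<^sup>*}"

lemma orbit_step: "x \<in> orbit W h v \<Longrightarrow> h x \<in> W \<Longrightarrow> h x \<in> orbit W h v"
  unfolding orbit_def by (auto intro: rtrancl_into_rtrancl)

lemma escapes_orbit:
  assumes "escapes W (graph_on W h) x" and "x \<in> orbit W h v"
  shows "escapes W (graph_on (orbit W h v) h) x"
  using assms
proof (induction rule: escapes_induct)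
  case (outside x)
  then show ?case by (simp add: escapes_outside)
next
  case (step x y)
  then have "escapes W (graph_on (orbit W h v) h) y"
    using orbit_step[of x W h v] escapes_outside[of y W] by auto
  then show ?case using step escapes_step[of x y] by auto
qed

text \<open>Start the extension with the \<open>h\<close>-walk of \<open>v\<close> reserved for the
  first branching and \<open>u\<close> using its \<open>f\<close>-arc, which leaves \<open>W\<close>
  at once. For the rest it suffices that \<open>u\<close> still escapes, because the
  \<open>f\<close>-walks lose only the arc at \<open>u\<close>.\<close>

lemma branching_split_orbit:
  fixes f h :: "'a \<Rightarrow> 'a"
  assumes "finite W"
    and f: "\<And>x. x \<in> W \<Longrightarrow> escapes W (graph_on W f) x"
    and h: "\<And>x. x \<in> W \<Longrightarrow> escapes W (graph_on W h) x"
    and "u \<in> W" "v \<in> W" and "f u \<notin> W" and u: "u \<notin> orbit W h v"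
    and B: "escapes W (graph_on (W - {u}) f \<union> graph_on (W - orbit W h v) h) u"
  shows "\<exists>X. X \<subseteq> W \<and> u \<notin> X \<and> escapes W (graph_on X h) v \<and>
    (\<forall>x\<in>W. escapes W (graph_on X h \<union> graph_on (W - X) f) x) \<and>
    (\<forall>x\<in>W. escapes W (graph_on X f \<union> graph_on (W - X) h) x)"
proof -
  let ?P = "orbit W h v"
  let ?R = "insert u ?P"
  have PW: "?P \<subseteq> W" by (auto simp: orbit_def)
  have v: "v \<in> ?P" using \<open>v \<in> W\<close> by (simp add: orbit_def)
  have P: "escapes W (graph_on ?P h) x" if "x \<in> ?P" for x
    using escapes_orbit[OF _ that] h PW that by blast
  have R: "escapes W (graph_on ?P h \<union> graph_on (?R - ?P) f) x" if "x \<in> ?R" for x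
  proof (cases "x = u")
    case True
    then show ?thesis using u escapes_outside[OF \<open>f u \<notin> W\<close>] by (intro escapes_step[of x "f u"]) auto
  next
    case False
    then show ?thesis using that by (intro escapes_mono[OF P]) auto
  qed
  have eq: "W - ?R \<union> ?P = W - {u}" using PW u by auto
  have B': "escapes W (graph_on (W - ?R \<union> ?P) f \<union> graph_on (W - ?P) h) x" if "x \<in> W" for x
    unfolding eq by (rule escapes_via[OF f[OF that] _ B]) (auto simp: without_def)
  obtain X where X: "X \<subseteq> W" "X \<inter> ?R = ?P"
      "\<forall>x\<in>W. escapes W (graph_on X h \<union> graph_on (W - X) f) x"
      "\<forall>x\<in>W. escapes W (graph_on X f \<union> graph_on (W - X) h) x"
    using branching_split_extend[of W ?R ?P f h] \<open>finite W\<close> \<open>u \<in> W\<close> PW f h R B' by blast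
  have "u \<notin> X" using X(2) u by blast
  moreover have "escapes W (graph_on X h) v"
    using X(2) by (intro escapes_mono[OF P[OF v]]) (auto simp: graph_on_def)
  ultimately show ?thesis using X by blast
qed

text \<open>If the \<open>h\<close>-walks of \<open>u\<close> and \<open>v\<close> are disjoint,
  reserving one leaves the other intact. If they merge, one of the two vertices can follow
  \<open>h\<close> to the meeting point and then \<open>f\<close> out of \<open>W\<close>, and the
  walk of the other is reserved.\<close>

lemma branching_split_separates:
  fixes f h :: "'a \<Rightarrow> 'a"
  assumes "finite W"
    and f: "\<And>x. x \<in> W \<Longrightarrow> escapes W (graph_on W f) x"
    and h: "\<And>x. x \<in> W \<Longrightarrow> escapes W (graph_on W h) x"
    and uv: "u \<in> W" "v \<in> W" "u \<noteq> v" and fuv: "f u \<notin> W" "f v \<notin> W"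
  shows "\<exists>X. X \<subseteq> W \<and>
    (u \<notin> X \<and> escapes W (graph_on X h) v \<or> v \<notin> X \<and> escapes W (graph_on X h) u) \<and>
    (\<forall>x\<in>W. escapes W (graph_on X h \<union> graph_on (W - X) f) x) \<and>
    (\<forall>x\<in>W. escapes W (graph_on X f \<union> graph_on (W - X) h) x)"
proof (cases "orbit W h u \<inter> orbit W h v = {}")
  case True
  have "u \<in> orbit W h u" using uv by (simp add: orbit_def)
  then have "u \<notin> orbit W h v" using True by blast
  moreover have "escapes W (graph_on (W - {u}) f \<union> graph_on (W - orbit W h v) h) u"
    using True by (intro escapes_mono[OF escapes_orbit[OF h[OF uv(1)] \<open>u \<in> orbit W h u\<close>]])
      (auto simp: graph_on_def orbit_def)
  ultimately show ?thesis
    using branching_split_orbit[of W f h u v] assms by blast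
next
  case False
  let ?h = "graph_on W h" and ?f = "graph_on W f"
  have "acyclic ?h"
    by (rule escapes_acyclic[OF h single_valued_graph_on]) auto
  moreover have "finite ?h"
    using \<open>finite W\<close> by (simp add: graph_on_def)
  ultimately have "wf (?h\<^sup>+)" by (simp add: finite_acyclic_wf wf_trancl)
  \<comment> \<open>\<open>p\<close> is the first vertex common to the two
    \<open>h\<close>-walks.\<close>
  then obtain p where p: "p \<in> orbit W h u" "p \<in> orbit W h v"
    and min: "\<And>x. (x, p) \<in> ?h\<^sup>+ \<Longrightarrow> x \<notin> orbit W h u \<inter> orbit W h v"
    using False by (metis Int_iff ex_in_conv wfE_min)
  \<comment> \<open>\<open>f\<close> takes \<open>u\<close> and \<open>v\<close> straight out of
    \<open>W\<close>, so the \<open>f\<close>-walk from \<open>p\<close> passes at most one of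
    them.\<close>
  have fesc: "\<not> ((p, u) \<in> ?f\<^sup>* \<and> (p, v) \<in> ?f\<^sup>*)"
  proof
    assume "(p, u) \<in> ?f\<^sup>* \<and> (p, v) \<in> ?f\<^sup>*"
    then have "(u, v) \<in> ?f\<^sup>* \<or> (v, u) \<in> ?f\<^sup>*"
      using single_valued_confluent[OF single_valued_graph_on] by metis
    moreover have "(a, b) \<notin> ?f\<^sup>*" if "f a \<notin> W" "b \<in> W" "a \<noteq> b" for a b
    proof
      assume "(a, b) \<in> ?f\<^sup>*"
      then have "(f a, b) \<in> ?f\<^sup>*" using that by (auto elim: converse_rtranclE)
      then show False using that by (auto elim: converse_rtranclE)
    qed
    ultimately show False using uv fuv by blast
  qed
  \<comment> \<open>The \<open>h\<close>-walk of \<open>b\<close> is reserved; \<open>a\<close>,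
    missed by the \<open>f\<close>-walk from \<open>p\<close>, has to escape on what is
    left.\<close>
  have main: "\<exists>X. X \<subseteq> W \<and> a \<notin> X \<and> escapes W (graph_on X h) b \<and>
      (\<forall>x\<in>W. escapes W (graph_on X h \<union> graph_on (W - X) f) x) \<and>
      (\<forall>x\<in>W. escapes W (graph_on X f \<union> graph_on (W - X) h) x)"
    if ab: "a \<in> W" "b \<in> W" "f a \<notin> W" "p \<in> orbit W h a" "p \<in> orbit W h b" "(p, a) \<notin> ?f\<^sup>*"
      and min: "\<And>x. (x, p) \<in> ?h\<^sup>+ \<Longrightarrow> x \<notin> orbit W h a \<inter> orbit W h b" for a b
  proof (rule branching_split_orbit[OF \<open>finite W\<close> f h ab(1-3)])
    let ?B = "graph_on (W - {a}) f \<union> graph_on (W - orbit W h b) h"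
    have ap: "(a, p) \<in> ?h\<^sup>*" using ab by (simp add: orbit_def)
    moreover have "a \<noteq> p" using ab(6) by auto
    ultimately have "(a, p) \<in> ?h\<^sup>+" by (simp add: rtrancl_eq_or_trancl)
    then show "a \<notin> orbit W h b" using min[of a] ab(1) by (auto simp: orbit_def)
    \<comment> \<open>Before \<open>p\<close> the \<open>h\<close>-walk of \<open>a\<close> is
      disjoint from that of \<open>b\<close>, so its arcs are still in \<open>?B\<close>.\<close>
    have "(x, p) \<in> ?B\<^sup>*" if "(x, p) \<in> ?h\<^sup>*" "x \<in> orbit W h a" for x
      using that
    proof (induction rule: converse_rtrancl_induct)
      case base
      then show ?case by simp
    next
      case (step x y)
      have "(x, p) \<in> ?h\<^sup>+" using step(1,2) by (rule rtrancl_into_trancl2)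
      then have "x \<notin> orbit W h b" using min step.prems by blast
      then have "(x, y) \<in> ?B" using step(1) by auto
      moreover have "y \<in> W" using step(2) ab(4) by (auto simp: orbit_def elim: converse_rtranclE)
      then have "y \<in> orbit W h a" using orbit_step[OF step.prems] step(1) by auto
      ultimately show ?case using step.IH by (meson converse_rtrancl_into_rtrancl)
    qed
    then have aB: "(a, p) \<in> ?B\<^sup>*" using ap ab(1) by (simp add: orbit_def)
    have "escapes W ?B x" if "escapes W ?f x" "(x, a) \<notin> ?f\<^sup>*" for x
      using that
    proof (induction rule: escapes_induct)
      case (outside x)
      then show ?case by (simp add: escapes_outside)
    next
      case (step x y)
      then have "(y, a) \<notin> ?f\<^sup>*" by (meson converse_rtrancl_into_rtrancl)
      moreover have "(x, y) \<in> ?B" using step by auto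
      ultimately show ?case using step escapes_step by metis
    qed
    then have "escapes W ?B p" using f ab by (auto simp: orbit_def)
    then show "escapes W ?B a" using aB escapes_rtrancl by metis
  qed
  show ?thesis
  proof (cases "(p, u) \<in> ?f\<^sup>*")
    case True
    then have "(p, v) \<notin> ?f\<^sup>*" using fesc by blast
    then show ?thesis using main[of v u] uv fuv p min by blast
  next
    case False
    then show ?thesis using main[of u v] uv fuv p min by blast
  qed
qed

lemma escapes_restrict:
  assumes "(x, y) \<in> A\<^sup>*" and "y \<notin> W"
  shows "escapes W {(x, y) \<in> A. x \<in> W} x"
  using assms(1)
proof (induction rule: converse_rtrancl_induct)
  case base
  then show ?case using assms(2) by (rule escapes_outside)
next
  case (step x z)
  then show ?case
    using escapes_outside[of x W] escapes_step[of x z "{(x, y) \<in> A. x \<in> W}" W] by blast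
qed

lemma rtrancl_backward_closed:
  assumes "(x, s) \<in> A\<^sup>*" and "s \<in> D" and "\<And>x y. (x, y) \<in> A \<Longrightarrow> y \<in> D \<Longrightarrow> x \<in> D"
  shows "x \<in> D"
  using assms(1) by (induction rule: converse_rtrancl_induct) (use assms in auto)

section \<open>Trees and roots of a forest\<close>

definition tree_at :: "'a set \<Rightarrow> ('a \<times> 'a) set \<Rightarrow> 'a \<Rightarrow> 'a set" where
  "tree_at V F r = {x \<in> V. (x, r) \<in> F\<^sup>*}"

text \<open>For a forest this is membership in a common tree, expressed through directed walks to
  the root.\<close>

definition linked :: "'a set \<Rightarrow> ('a \<times> 'a) set \<Rightarrow> 'a \<Rightarrow> 'a \<Rightarrow> bool" where
  "linked V F x y \<longleftrightarrow> (\<exists>r\<in>roots V F. (x, r) \<in> F\<^sup>* \<and> (y, r) \<in> F\<^sup>*)"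

lemma is_forest_iff: "is_forest F \<longleftrightarrow> single_valued F \<and> acyclic F"
  by (auto simp: is_forest_def single_valued_def)

lemma root_exists:
  assumes "finite V" and "F \<subseteq> V \<times> V" and "is_forest F" and "x \<in> V"
  shows "\<exists>r\<in>roots V F. (x, r) \<in> F\<^sup>*"
proof -
  have "finite F" using assms(1,2) by (meson finite_SigmaI finite_subset)
  then have "wf (F\<inverse>)" using assms(3) by (simp add: finite_acyclic_wf_converse is_forest_iff)
  then show ?thesis using \<open>x \<in> V\<close>
  proof (induction x rule: wf_induct_rule)
    case (less x)
    show ?case
    proof (cases "x \<in> roots V F")
      case False
      then obtain y where "(x, y) \<in> F" using less.prems by (auto simp: roots_def)
      then show ?thesis using less.IH[of y] assms(2) by (auto intro: converse_rtrancl_into_rtrancl)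
    qed auto
  qed
qed

lemma root_rtrancl: "r \<in> roots V F \<Longrightarrow> (r, y) \<in> F\<^sup>* \<Longrightarrow> y = r"
  by (auto simp: roots_def elim: converse_rtranclE)

lemma rtrancl_to_root:
  assumes "single_valued F" and "r \<in> roots V F" and "(x, r) \<in> F\<^sup>*" and "(x, y) \<in> F\<^sup>*"
  shows "(y, r) \<in> F\<^sup>*"
  using single_valued_confluent[OF assms(1,3,4)] root_rtrancl[OF assms(2)] by auto

lemma root_unique:
  assumes "single_valued F" and "r \<in> roots V F" and "q \<in> roots V F"
    and "(x, r) \<in> F\<^sup>*" and "(x, q) \<in> F\<^sup>*"
  shows "q = r"
  using rtrancl_to_root[OF assms(1,2,4,5)] root_rtrancl[OF assms(3)] by auto

lemma linked_root:
  assumes "single_valued F" and "linked V F x y" and "r \<in> roots V F" and "(x, r) \<in> F\<^sup>*"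
  shows "(y, r) \<in> F\<^sup>*"
  using assms root_unique unfolding linked_def by metis

lemma linked_sym: "linked V F x y \<Longrightarrow> linked V F y x"
  by (auto simp: linked_def)

text \<open>Crossing an arc in either direction does not change the root that is reached.\<close>

lemma connected_iff_linked:
  assumes "finite V" and "F \<subseteq> V \<times> V" and "is_forest F" and "x \<in> V"
  shows "(x, y) \<in> (F \<union> F\<inverse>)\<^sup>* \<longleftrightarrow> linked V F x y"
proof
  obtain r where r: "r \<in> roots V F" "(x, r) \<in> F\<^sup>*" using root_exists[OF assms] by blast
  have sv: "single_valued F" using assms by (simp add: is_forest_iff)
  assume "(x, y) \<in> (F \<union> F\<inverse>)\<^sup>*"
  then have "(y, r) \<in> F\<^sup>*"
  proof (induction rule: rtrancl_induct)
    case base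
    then show ?case using r by simp
  next
    case (step y z)
    then show ?case using rtrancl_to_root[OF sv r(1)] by (auto intro: converse_rtrancl_into_rtrancl)
  qed
  then show "linked V F x y" using r by (auto simp: linked_def)
next
  assume "linked V F x y"
  then obtain r where "(x, r) \<in> F\<^sup>*" "(y, r) \<in> F\<^sup>*" by (auto simp: linked_def)
  moreover from this(2) have "(r, y) \<in> (F\<inverse>)\<^sup>*" by (rule rtrancl_converseI)
  ultimately show "(x, y) \<in> (F \<union> F\<inverse>)\<^sup>*"
    by (meson Un_upper1 Un_upper2 rtrancl_mono rtrancl_trans subsetD)
qed

lemma trees_eq_linked:
  assumes "finite V" and "F \<subseteq> V \<times> V" and "is_forest F"
  shows "trees V F = (\<lambda>x. {y \<in> V. linked V F x y}) ` V"
proof -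
  have "{(x, y). x \<in> V \<and> y \<in> V \<and> (x, y) \<in> (F \<union> F\<inverse>)\<^sup>*} `` {x} = {y \<in> V. linked V F x y}"
    if "x \<in> V" for x
    using connected_iff_linked[OF assms that] that by auto
  then show ?thesis unfolding trees_def quotient_def by auto
qed

text \<open>Trees correspond to roots through \<open>tree_at\<close>, so exchanges need only keep
  track of roots.\<close>

lemma card_trees:
  assumes "finite V" and "F \<subseteq> V \<times> V" and "is_forest F"
  shows "card (trees V F) = card (roots V F)"
proof -
  have sv: "single_valued F" using assms by (simp add: is_forest_iff)
  have tree: "{y \<in> V. linked V F x y} = tree_at V F r" if "r \<in> roots V F" "(x, r) \<in> F\<^sup>*" for x r
    using linked_root[OF sv _ that] that by (auto simp: tree_at_def linked_def)
  have rV: "roots V F \<subseteq> V" by (auto simp: roots_def)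
  have "trees V F = tree_at V F ` roots V F"
    unfolding trees_eq_linked[OF assms]
  proof (intro equalityI image_subsetI)
    fix x assume "x \<in> V"
    then show "{y \<in> V. linked V F x y} \<in> tree_at V F ` roots V F"
      using root_exists[OF assms] tree by blast
  next
    fix r assume "r \<in> roots V F"
    then show "tree_at V F r \<in> (\<lambda>x. {y \<in> V. linked V F x y}) ` V"
      using tree[of r r] rV by blast
  qed
  moreover have "inj_on (tree_at V F) (roots V F)"
  proof (rule inj_onI)
    fix r q assume rq: "r \<in> roots V F" "q \<in> roots V F" "tree_at V F r = tree_at V F q"
    then have "r \<in> tree_at V F q" using rV by (auto simp: tree_at_def)
    then show "r = q" using root_rtrancl[OF rq(1)] by (auto simp: tree_at_def)
  qed
  ultimately show ?thesis by (simp add: card_image)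
qed

section \<open>Exchanging out-arcs between two arc sets\<close>

text \<open>\<open>swap X H F\<close> and \<open>swap X F H\<close> together contain every arc as
  often as \<open>F\<close> and \<open>H\<close> do; hence the total weight and the total number of
  roots are preserved.\<close>

definition swap :: "'a set \<Rightarrow> ('a \<times> 'a) set \<Rightarrow> ('a \<times> 'a) set \<Rightarrow> ('a \<times> 'a) set" where
  "swap X H F = {(x, y) \<in> H. x \<in> X} \<union> {(x, y) \<in> F. x \<notin> X}"

lemma swap_iff: "(x, y) \<in> swap X H F \<longleftrightarrow> (if x \<in> X then (x, y) \<in> H else (x, y) \<in> F)"
  by (auto simp: swap_def)

lemma roots_swap: "roots V (swap X H F) = roots V F - X \<union> roots V H \<inter> X"
  by (auto simp: roots_def swap_iff)

lemma single_valued_swap: "single_valued F \<Longrightarrow> single_valued H \<Longrightarrow> single_valued (swap X H F)"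
  unfolding single_valued_def swap_iff by (metis (full_types))

lemma acyclic_Un_finite:
  assumes "finite A" "finite B" "acyclic A" "acyclic B" "Domain A \<inter> Range B = {}"
  shows "acyclic (A \<union> B)"
  using assms by (meson finite_acyclic_wf wf_Un wf_acyclic)

text \<open>A cycle mixing both kinds of arcs would cross the boundary of \<open>X\<close> in both
  directions, and one direction is blocked.\<close>

lemma acyclic_swap:
  assumes "finite F" "finite H" "acyclic F" "acyclic H"
    and "(\<forall>x y. (x, y) \<in> F \<and> x \<notin> X \<longrightarrow> y \<notin> X) \<or> (\<forall>x y. (x, y) \<in> H \<and> x \<in> X \<longrightarrow> y \<in> X)"
  shows "acyclic (swap X H F)"
proof -
  let ?A = "{(x, y) \<in> H. x \<in> X}" and ?B = "{(x, y) \<in> F. x \<notin> X}"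
  have fin: "finite ?A" "finite ?B" using assms(1,2) by (auto intro: finite_subset[rotated])
  have ac: "acyclic ?A" "acyclic ?B" using assms(3,4) by (auto intro: acyclic_subset)
  have "Domain ?A \<inter> Range ?B = {} \<or> Domain ?B \<inter> Range ?A = {}" using assms(5) by blast
  then show ?thesis
    unfolding swap_def using acyclic_Un_finite[OF fin ac] acyclic_Un_finite[OF fin(2,1) ac(2,1)]
    by (auto simp: Un_commute)
qed

text \<open>No arc of \<open>F\<close> enters \<open>D\<close>, so a walk ending in \<open>D\<close>
  was never outside and uses only arcs of \<open>H\<close>.\<close>

lemma rtrancl_swap_into:
  assumes "(x, s) \<in> (swap D H F)\<^sup>*" and "s \<in> D"
    and "\<And>x y. (x, y) \<in> F \<Longrightarrow> y \<in> D \<Longrightarrow> x \<in> D"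
  shows "x \<in> D \<and> (x, s) \<in> H\<^sup>*"
  using assms(1)
proof (induction rule: converse_rtrancl_induct)
  case base
  then show ?case using assms(2) by simp
next
  case (step x y)
  then have "x \<in> D" using assms(3) by (auto simp: swap_iff split: if_splits)
  then show ?case using step by (auto simp: swap_iff intro: converse_rtrancl_into_rtrancl)
qed

lemma rtrancl_closed_subset:
  assumes "(x, s) \<in> H\<^sup>*" and "x \<in> D" and "\<And>x y. (x, y) \<in> H \<Longrightarrow> x \<in> D \<Longrightarrow> y \<in> D"
    and "\<And>x y. (x, y) \<in> H \<Longrightarrow> x \<in> D \<Longrightarrow> (x, y) \<in> A"
  shows "(x, s) \<in> A\<^sup>*"
  using assms(1,2)
  by (induction rule: converse_rtrancl_induct)
    (use assms(3,4) in \<open>blast intro: converse_rtrancl_into_rtrancl\<close>)+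

section \<open>Exchange families of forests\<close>

text \<open>
  Abstracts the family of minimal forests with \<open>k\<close> trees: exchanging the out-arcs of a set of
  vertices between two members never produces \<open>k - 1\<close> trees (that is the strict convexity of the
  minimal weights at \<open>k\<close>), and stays in the family if it produces \<open>k\<close> trees.
\<close>

locale exchange_family =
  fixes V :: "'a set" and \<F> :: "('a \<times> 'a) set set" and k :: nat
  assumes finite_V: "finite V"
    and arcs: "F \<in> \<F> \<Longrightarrow> F \<subseteq> V \<times> V"
    and forest: "F \<in> \<F> \<Longrightarrow> is_forest F"
    and card_roots: "F \<in> \<F> \<Longrightarrow> card (roots V F) = k"
    and no_loss: "F \<in> \<F> \<Longrightarrow> H \<in> \<F> \<Longrightarrow> acyclic (swap X H F) \<Longrightarrow> acyclic (swap X F H) \<Longrightarrow>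
      Suc (card (roots V (swap X H F))) \<noteq> k"
    and exchange: "F \<in> \<F> \<Longrightarrow> H \<in> \<F> \<Longrightarrow> acyclic (swap X H F) \<Longrightarrow> acyclic (swap X F H) \<Longrightarrow>
      card (roots V (swap X H F)) = k \<Longrightarrow> swap X H F \<in> \<F>"
begin

lemma sv: "F \<in> \<F> \<Longrightarrow> single_valued F" and acyc: "F \<in> \<F> \<Longrightarrow> acyclic F"
  using forest is_forest_iff by auto

lemma fin: "F \<in> \<F> \<Longrightarrow> finite F"
  using finite_V arcs by (meson finite_SigmaI finite_subset)

lemma roots_V: "roots V F \<subseteq> V"
  by (auto simp: roots_def)

lemma finite_roots: "finite (roots V F)"
  using finite_V roots_V finite_subset by blast

lemma root_ex: "F \<in> \<F> \<Longrightarrow> x \<in> V \<Longrightarrow> \<exists>r\<in>roots V F. (x, r) \<in> F\<^sup>*"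
  using root_exists[OF finite_V] arcs forest by blast

lemma tree_enter: "F \<in> \<F> \<Longrightarrow> (x, y) \<in> F \<Longrightarrow> y \<in> tree_at V F r \<Longrightarrow> x \<in> tree_at V F r"
  using arcs by (auto simp: tree_at_def intro: converse_rtrancl_into_rtrancl)

lemma tree_stay:
  assumes "F \<in> \<F>" "r \<in> roots V F" "(x, y) \<in> F" "x \<in> tree_at V F r"
  shows "y \<in> tree_at V F r"
  using assms rtrancl_to_root[OF sv[OF assms(1)] assms(2)] arcs by (auto simp: tree_at_def)

lemma root_in_tree: "r \<in> roots V F \<Longrightarrow> r \<in> tree_at V F r"
  using roots_V by (auto simp: tree_at_def)

lemma roots_tree: "r \<in> roots V F \<Longrightarrow> roots V F \<inter> tree_at V F r = {r}"
  using roots_V by (auto simp: tree_at_def dest: root_rtrancl)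

lemma acyclic_swap_tree:
  assumes "F \<in> \<F>" "H \<in> \<F>" "r \<in> roots V F"
  shows "acyclic (swap (tree_at V F r) H F)" "acyclic (swap (tree_at V F r) F H)"
proof -
  show "acyclic (swap (tree_at V F r) H F)"
    using tree_enter[OF assms(1)]
    by (intro acyclic_swap fin[OF assms(1)] fin[OF assms(2)] acyc[OF assms(1)] acyc[OF assms(2)]) blast
  show "acyclic (swap (tree_at V F r) F H)"
    using tree_stay[OF assms(1,3)]
    by (intro acyclic_swap fin[OF assms(1)] fin[OF assms(2)] acyc[OF assms(1)] acyc[OF assms(2)]) blast
qed

text \<open>Otherwise giving the tree the arcs of \<open>H\<close> would destroy the root
  \<open>r\<close> and create none, leaving \<open>k - 1\<close> roots.\<close>

lemma tree_contains_root:
  assumes "F \<in> \<F>" "H \<in> \<F>" "r \<in> roots V F"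
  shows "\<exists>q\<in>roots V H. q \<in> tree_at V F r"
proof (rule ccontr)
  assume "\<not> ?thesis"
  then have "roots V (swap (tree_at V F r) H F) = roots V F - {r}"
    using roots_tree[OF assms(3)] by (auto simp: roots_swap)
  moreover have "Suc (card (roots V F - {r})) = k"
    using card_Suc_Diff1[OF finite_roots assms(3)] card_roots[OF assms(1)] by simp
  ultimately show False using no_loss[OF assms(1,2) acyclic_swap_tree[OF assms]] by simp
qed

text \<open>Sending each root of \<open>H\<close> to the root of its tree in \<open>F\<close> is
  surjective by \<open>tree_contains_root\<close>, hence injective, both forests having
  \<open>k\<close> roots.\<close>

lemma tree_root_unique:
  assumes "F \<in> \<F>" "H \<in> \<F>" "r \<in> roots V F"
    and "q \<in> roots V H" "q \<in> tree_at V F r" "p \<in> roots V H" "p \<in> tree_at V F r"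
  shows "p = q"
proof -
  obtain \<rho> where \<rho>: "\<And>x. x \<in> V \<Longrightarrow> \<rho> x \<in> roots V F \<and> (x, \<rho> x) \<in> F\<^sup>*"
    using root_ex[OF assms(1)] by metis
  have eq: "\<rho> x = s" if "s \<in> roots V F" "x \<in> tree_at V F s" for x s
    using \<rho>[of x] that root_unique[OF sv[OF assms(1)]] by (auto simp: tree_at_def)
  have "\<rho> ` roots V H = roots V F"
  proof
    show "\<rho> ` roots V H \<subseteq> roots V F" using \<rho> roots_V by blast
    show "roots V F \<subseteq> \<rho> ` roots V H"
      using tree_contains_root[OF assms(1,2)] eq by blast
  qed
  then have "inj_on \<rho> (roots V H)"
    using card_roots assms(1,2) by (intro eq_card_imp_inj_on finite_roots) simp
  then show ?thesis using assms eq by (metis inj_onD)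
qed

lemma tree_root:
  assumes "F \<in> \<F>" "H \<in> \<F>" "r \<in> roots V F"
  obtains q where "roots V H \<inter> tree_at V F r = {q}"
  using tree_contains_root[OF assms] tree_root_unique[OF assms] by blast

text \<open>Each forest has exactly one root in the tree, so the exchange keeps the number of
  roots.\<close>

lemma swap_tree:
  assumes "F \<in> \<F>" "H \<in> \<F>" "r \<in> roots V F"
  shows "swap (tree_at V F r) H F \<in> \<F>" "swap (tree_at V F r) F H \<in> \<F>"
proof -
  let ?D = "tree_at V F r"
  obtain q where q: "roots V H \<inter> ?D = {q}" using tree_root[OF assms] .
  have r: "roots V F \<inter> ?D = {r}" using roots_tree assms by blast
  have card: "card (roots V K - ?D \<union> {p}) = k" if "K \<in> \<F>" "roots V K \<inter> ?D = {s}" "p \<in> ?D" for K s p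
  proof -
    have "roots V K - ?D = roots V K - {s}" "s \<in> roots V K" using that by auto
    then have "Suc (card (roots V K - ?D)) = k"
      using card_Suc_Diff1[OF finite_roots, of s K] card_roots that by simp
    then show ?thesis using that(3) finite_roots by simp
  qed
  have "card (roots V (swap ?D H F)) = k"
    unfolding roots_swap q using card[OF assms(1) r] q by blast
  then show "swap ?D H F \<in> \<F>" using exchange assms acyclic_swap_tree by blast
  have "card (roots V (swap ?D F H)) = k"
    unfolding roots_swap r using card[OF assms(2) q] r by blast
  then show "swap ?D F H \<in> \<F>" using exchange assms acyclic_swap_tree by blast
qed

text \<open>
  Give the tree \<open>D\<close> of \<open>F\<close> the arcs of \<open>H\<close>: the new tree rooted in \<open>D\<close> lies inside \<open>D\<close> and contains a
  root of \<open>F\<close> and a root of \<open>G\<close>, which can only be \<open>r\<close> and \<open>q\<close>; both run to the same root along \<open>H\<close>.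
\<close>

lemma roots_inseparable:
  assumes "F \<in> \<F>" "G \<in> \<F>" "H \<in> \<F>" and r: "r \<in> roots V F" and q: "q \<in> roots V G" "(q, r) \<in> F\<^sup>*"
  shows "linked V H r q"
proof -
  let ?D = "tree_at V F r"
  let ?K = "swap ?D H F"
  obtain s where s: "roots V H \<inter> ?D = {s}" using tree_root[OF assms(1,3) r] .
  have K: "?K \<in> \<F>" using swap_tree assms by blast
  have sK: "s \<in> roots V ?K" using s by (auto simp: roots_swap)
  have into: "x \<in> ?D \<and> (x, s) \<in> H\<^sup>*" if "x \<in> tree_at V ?K s" for x
    using that s rtrancl_swap_into[of x s ?D H F] tree_enter[OF assms(1)]
    by (auto simp: tree_at_def[of V ?K])
  obtain r' where r': "r' \<in> roots V F" "r' \<in> tree_at V ?K s"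
    using tree_contains_root[OF K assms(1) sK] by blast
  have "r' = r" using into[OF r'(2)] r'(1) roots_tree[OF r] by blast
  obtain q' where q': "q' \<in> roots V G" "q' \<in> tree_at V ?K s"
    using tree_contains_root[OF K assms(2) sK] by blast
  have "q \<in> ?D" using q roots_V by (auto simp: tree_at_def)
  then have "q' = q" using tree_root_unique[OF assms(1,2) r q(1) _ q'(1)] into[OF q'(2)] by blast
  then show ?thesis using into r' q' s \<open>r' = r\<close> by (auto simp: linked_def)
qed

text \<open>Off the roots every vertex has exactly one out-arc; this presents the forest as a map,
  as the branching lemmas require.\<close>

lemma graph_on_arcs:
  assumes "F \<in> \<F>" and "W \<subseteq> V" and "W \<inter> roots V F = {}"
  shows "graph_on W (\<lambda>x. SOME y. (x, y) \<in> F) = {(x, y) \<in> F. x \<in> W}"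
proof -
  have "(x, SOME y. (x, y) \<in> F) \<in> F" if "x \<in> W" for x
    using that assms(2,3) by (intro someI_ex[of "\<lambda>y. (x, y) \<in> F"]) (auto simp: roots_def)
  then show ?thesis using sv[OF assms(1)] by (auto simp: graph_on_def dest: single_valuedD)
qed

text \<open>\<open>u\<close> and \<open>v\<close> stand for vertices of one atom, \<open>r0\<close>
  for a root in the atom of \<open>m\<close>, and \<open>H\<close> shows that \<open>n\<close> lies
  outside the atom of \<open>u\<close>. The contradiction comes from a member \<open>G\<close> that
  separates \<open>u\<close> from \<open>v\<close>.\<close>

lemma exit_to_labeled_is_unique:
  assumes F: "F \<in> \<F>" and um: "(u, m) \<in> F" and vn: "(v, n) \<in> F" and "u \<noteq> v"
    and uv: "\<And>H. H \<in> \<F> \<Longrightarrow> linked V H u v"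
    and F0: "F0 \<in> \<F>" "r0 \<in> roots V F0" and m: "\<And>H. H \<in> \<F> \<Longrightarrow> linked V H m r0"
    and H: "H \<in> \<F>" and un: "\<not> linked V H u n"
  shows False
proof -
  have inV: "u \<in> V" "v \<in> V" "m \<in> V" "n \<in> V" using um vn arcs[OF F] by auto
  obtain s where s: "s \<in> roots V H" "(n, s) \<in> H\<^sup>*" using root_ex[OF H inV(4)] by blast
  define D where "D = tree_at V H s"
  have nD: "n \<in> D" using s inV by (simp add: D_def tree_at_def)
  have sD: "s \<in> D" using root_in_tree s by (simp add: D_def)
  have uD: "u \<notin> D" using un s by (auto simp: D_def tree_at_def linked_def)
  have vD: "v \<notin> D"
    using uD linked_root[OF sv[OF H] linked_sym[OF uv[OF H]] s(1)] inV by (auto simp: D_def tree_at_def)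
  have Dstay: "y \<in> D" if "(x, y) \<in> H" "x \<in> D" for x y
    using tree_stay[OF H s(1)] that by (simp add: D_def)
  \<comment> \<open>\<open>K\<close> follows \<open>H\<close> on the tree \<open>D\<close> and
    \<open>F\<close> elsewhere, so \<open>v\<close> runs through \<open>n\<close> to
    \<open>s\<close>.\<close>
  define K where "K = swap D H F"
  have K: "K \<in> \<F>" using swap_tree(2)[OF H F s(1)] by (simp add: K_def D_def)
  have KD: "(x, y) \<in> K \<longleftrightarrow> (x, y) \<in> H" if "x \<in> D" for x y using that by (simp add: K_def swap_iff)
  have sK: "s \<in> roots V K" using s sD by (simp add: K_def roots_swap)
  have umK: "(u, m) \<in> K" and vnK: "(v, n) \<in> K" using um vn uD vD by (simp_all add: K_def swap_iff)
  have DK: "(x, s) \<in> K\<^sup>*" if "x \<in> D" for x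
    using that rtrancl_closed_subset[of x s H D K] Dstay KD by (auto simp: D_def tree_at_def)
  have vs: "(v, s) \<in> K\<^sup>*" using vnK DK[OF nD] by (rule converse_rtrancl_into_rtrancl)
  then have us: "(u, s) \<in> K\<^sup>*" using linked_root[OF sv[OF K] linked_sym[OF uv[OF K]] sK] by blast
  then have "(m, s) \<in> K\<^sup>*" using rtrancl_to_root[OF sv[OF K] sK us] umK by blast
  then have "(r0, s) \<in> K\<^sup>*" using linked_root[OF sv[OF K] m[OF K] sK] by blast
  \<comment> \<open>\<open>s\<close> and \<open>r0\<close> are roots of \<open>K\<close> and
    \<open>F0\<close> in one tree of \<open>K\<close>, so \<open>H\<close> cannot separate them;
    this forces \<open>m\<close> into \<open>D\<close>.\<close>
  then have "linked V H s r0" using roots_inseparable[OF K F0(1) H sK F0(2)] by blast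
  then have "(r0, s) \<in> H\<^sup>*" using linked_root[OF sv[OF H] _ s(1)] by blast
  then have "(m, s) \<in> H\<^sup>*" using linked_root[OF sv[OF H] linked_sym[OF m[OF H]] s(1)] by blast
  then have mD: "m \<in> D" using inV by (simp add: D_def tree_at_def)

  \<comment> \<open>\<open>K\<close> and \<open>L\<close> agree off \<open>W\<close>: on
    \<open>D\<close> both follow \<open>H\<close>, outside \<open>D'\<close> both follow
    \<open>K\<close>. On \<open>W\<close>, \<open>K\<close> follows \<open>F\<close> while
    \<open>L\<close> follows \<open>H\<close>.\<close>
  define D' where "D' = tree_at V K s"
  define W where "W = D' - D"
  define L where "L = swap D' H K"
  have L: "L \<in> \<F>" using swap_tree(1)[OF K H sK] by (simp add: L_def D'_def)
  have D'enter: "x \<in> D'" if "(x, y) \<in> K" "y \<in> D'" for x y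
    using tree_enter[OF K] that by (simp add: D'_def)
  have WV: "W \<subseteq> V" by (auto simp: W_def D'_def tree_at_def)
  have DD': "D \<subseteq> D'" using DK by (auto simp: D_def D'_def tree_at_def)
  \<comment> \<open>The only root of \<open>K\<close> or of \<open>H\<close> in \<open>D'\<close> is
    \<open>s\<close>, which lies in \<open>D\<close>.\<close>
  have WK: "W \<inter> roots V K = {}"
    using roots_tree[OF sK] sD by (auto simp: W_def D'_def)
  have WH: "W \<inter> roots V H = {}"
    using tree_root_unique[OF K H sK s(1)] sD DD' by (auto simp: W_def D'_def)
  define f where "f = (\<lambda>x. SOME y. (x, y) \<in> K)"
  define h where "h = (\<lambda>x. SOME y. (x, y) \<in> H)"
  have f: "graph_on W f = {(x, y) \<in> K. x \<in> W}"
    unfolding f_def by (rule graph_on_arcs[OF K WV WK])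
  have h: "graph_on W h = {(x, y) \<in> H. x \<in> W}"
    unfolding h_def by (rule graph_on_arcs[OF H WV WH])
  have fK: "(x, y) \<in> K \<longleftrightarrow> y = f x" and hH: "(x, y) \<in> H \<longleftrightarrow> y = h x" if "x \<in> W" for x y
    using that graph_on_iff[of x y W f] graph_on_iff[of x y W h] unfolding f h by auto
  have fesc: "escapes W (graph_on W f) x" if "x \<in> W" for x
    unfolding f using that sD by (intro escapes_restrict[of x s]) (auto simp: W_def D'_def tree_at_def)
  have hesc: "escapes W (graph_on W h) x" if xW: "x \<in> W" for x
  proof -
    obtain q where "q \<in> roots V H" "(x, q) \<in> H\<^sup>*" using root_ex[OF H] xW WV by blast
    then show ?thesis unfolding h using WH by (intro escapes_restrict[of x q]) auto
  qed
  have uvW: "u \<in> W" "v \<in> W" using us vs uD vD inV by (auto simp: W_def D'_def tree_at_def)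
  have "f u = m" "f v = n" using fK uvW umK vnK by auto
  then have "f u \<notin> W" "f v \<notin> W" using mD nD by (auto simp: W_def)
  then obtain X where X: "X \<subseteq> W"
      "u \<notin> X \<and> escapes W (graph_on X h) v \<or> v \<notin> X \<and> escapes W (graph_on X h) u"
      "\<forall>x\<in>W. escapes W (graph_on X h \<union> graph_on (W - X) f) x"
      "\<forall>x\<in>W. escapes W (graph_on X f \<union> graph_on (W - X) h) x"
    using branching_split_separates[of W f h u v] finite_subset[OF WV finite_V] fesc hesc uvW \<open>u \<noteq> v\<close>
    by blast
  \<comment> \<open>\<open>D\<close> is closed under the arcs of \<open>K\<close> and nothing enters
    \<open>D'\<close>, so \<open>K\<close> never enters \<open>W\<close> from outside. Acyclicity
    can thus be checked separately on and off \<open>W\<close>.\<close>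
  have Wout: "y \<notin> W" if "(x, y) \<in> K" "x \<notin> W" for x y
    using that D'enter[of x y] Dstay[of x y] KD[of x y] by (auto simp: W_def)
  have acyclic: "acyclic (A \<union> {(x, y) \<in> K. x \<notin> W})"
    if "\<forall>x\<in>W. escapes W A x" "Domain A \<subseteq> W" "single_valued A" "finite A" for A
  proof (rule acyclic_Un_finite)
    show "acyclic A" by (rule escapes_acyclic[of W, OF _ that(3,2)]) (use that(1) in blast)
    show "acyclic {(x, y) \<in> K. x \<notin> W}" using acyc[OF K] by (rule acyclic_subset) auto
    show "finite {(x, y) \<in> K. x \<notin> W}" using fin[OF K] by (rule finite_subset[rotated]) auto
    show "Domain A \<inter> Range {(x, y) \<in> K. x \<notin> W} = {}" using that(2) Wout by blast
  qed (fact that)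
  have svfin: "Domain (graph_on X a \<union> graph_on (W - X) b) \<subseteq> W \<and>
      single_valued (graph_on X a \<union> graph_on (W - X) b) \<and> finite (graph_on X a \<union> graph_on (W - X) b)"
    for a b :: "'a \<Rightarrow> 'a"
    using X(1) finite_subset[OF WV finite_V] finite_subset[OF X(1)]
    by (auto simp: single_valued_def graph_on_def)
  have LW: "(x, y) \<in> L \<longleftrightarrow> (x, y) \<in> H" if "x \<in> W" for x y
    using that by (simp add: L_def swap_iff W_def)
  have LnW: "(x, y) \<in> L \<longleftrightarrow> (x, y) \<in> K" if "x \<notin> W" for x y
    using that KD[of x y] by (auto simp: L_def swap_iff W_def)
  \<comment> \<open>\<open>G\<close> takes its arcs on \<open>W\<close> from the split; as
    \<open>W\<close> contains no root of \<open>K\<close> or \<open>L\<close>, it keeps the roots of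
    \<open>K\<close> and is again a member.\<close>
  define G where "G = swap X L K"
  have "G = (graph_on X h \<union> graph_on (W - X) f) \<union> {(x, y) \<in> K. x \<notin> W}"
    unfolding G_def using X(1) fK hH LW by (auto simp: swap_iff split: if_splits)
  then have "acyclic G" using acyclic[OF X(3)] svfin by simp
  have "(x, y) \<in> swap X K L \<longleftrightarrow>
      (x, y) \<in> (graph_on X f \<union> graph_on (W - X) h) \<union> {(x, y) \<in> K. x \<notin> W}" for x y
    using X(1) fK hH LW LnW by (cases "x \<in> W") (auto simp: swap_iff)
  then have "swap X K L = (graph_on X f \<union> graph_on (W - X) h) \<union> {(x, y) \<in> K. x \<notin> W}"
    by (intro set_eqI) (simp only: split_paired_all)
  then have "acyclic (swap X K L)" using acyclic[OF X(4)] svfin by simp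
  have "roots V L \<inter> W = {}" using WH LW by (auto simp: roots_def)
  then have rootsG: "roots V G = roots V K"
    unfolding G_def roots_swap using X(1) WK by blast
  then have G: "G \<in> \<F>"
    using exchange[OF K L, of X] \<open>acyclic G\<close> \<open>acyclic (swap X K L)\<close> card_roots[OF K] by (simp add: G_def)
  have sG: "s \<in> roots V G" using sK rootsG by simp
  have GD: "(x, y) \<in> G \<longleftrightarrow> (x, y) \<in> H" if "x \<in> D" for x y
    using that X(1) KD by (auto simp: G_def swap_iff W_def)
  have DG: "(x, s) \<in> G\<^sup>*" if "x \<in> D" for x
    using that rtrancl_closed_subset[of x s H D G] Dstay GD by (auto simp: D_def tree_at_def)
  have hX: "graph_on X h \<subseteq> G \<inter> H" using X(1) LW hH by (auto simp: G_def swap_iff)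
  \<comment> \<open>In \<open>G\<close>, \<open>a\<close> steps into \<open>D\<close> and ends at
    \<open>s\<close>, while \<open>b\<close> follows \<open>H\<close> out of \<open>W\<close>. That
    walk cannot end in \<open>D\<close>, a tree of \<open>H\<close> without \<open>b\<close>; so it
    ends outside \<open>D'\<close>, which no arc of \<open>G\<close> enters.\<close>
  have sep: False
    if a: "a \<in> W" "a \<notin> X" "(a, c) \<in> K" "c \<in> D" and b: "b \<in> W" "escapes W (graph_on X h) b"
      and ab: "linked V G a b" for a b c
  proof -
    have "(a, c) \<in> G" using a by (simp add: G_def swap_iff)
    then have "(a, s) \<in> G\<^sup>*" using DG[OF a(4)] by (rule converse_rtrancl_into_rtrancl)
    then have bs: "(b, s) \<in> G\<^sup>*" using linked_root[OF sv[OF G] ab sG] by blast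
    obtain y where y: "y \<notin> W" "(b, y) \<in> (graph_on X h)\<^sup>*" using b by (auto simp: escapes_def)
    have byG: "(b, y) \<in> G\<^sup>*" and byH: "(b, y) \<in> H\<^sup>*" using y(2) hX rtrancl_mono by blast+
    have "y \<notin> D"
    proof
      assume "y \<in> D"
      then have "(b, s) \<in> H\<^sup>*" using byH by (auto simp: D_def tree_at_def)
      then show False using b(1) WV by (auto simp: W_def D_def tree_at_def)
    qed
    then have "y \<notin> D'" using y(1) by (simp add: W_def)
    moreover have "(y, s) \<in> G\<^sup>*" using rtrancl_to_root[OF sv[OF G] sG bs byG] .
    moreover have "x \<in> D'" if "(x, y) \<in> G" "y \<in> D'" for x y
      using that D'enter[of x y] X(1) by (auto simp: G_def swap_iff W_def split: if_splits)
    ultimately show False using rtrancl_backward_closed[of y s G D'] sD DD' by blast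
  qed
  show False
    using X(2) sep[OF uvW(1) _ umK mD uvW(2)] sep[OF uvW(2) _ vnK nD uvW(1)] uv[OF G]
      linked_sym[OF uv[OF G]] by blast
qed

end

section \<open>Atoms of the generated algebra\<close>

lemma gen_algebra_subset:
  assumes "\<And>A. A \<in> G \<Longrightarrow> A \<subseteq> V" and "A \<in> gen_algebra V G"
  shows "A \<subseteq> V"
  using assms(2) by (induction rule: gen_algebra.induct) (use assms(1) in auto)

lemma gen_algebra_Int:
  assumes "A \<subseteq> V" "B \<subseteq> V" "A \<in> gen_algebra V G" "B \<in> gen_algebra V G"
  shows "A \<inter> B \<in> gen_algebra V G"
proof -
  have "A \<inter> B = V - ((V - A) \<union> (V - B))" using assms(1,2) by blast
  then show ?thesis using assms(3,4) by (metis gen_algebra.compl gen_algebra.union)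
qed

lemma gen_algebra_saturated:
  assumes "\<And>A. A \<in> G \<Longrightarrow> x \<in> A \<longleftrightarrow> y \<in> A" and "x \<in> V" "y \<in> V" and "A \<in> gen_algebra V G"
  shows "x \<in> A \<longleftrightarrow> y \<in> A"
  using assms(4) by (induction rule: gen_algebra.induct) (use assms in auto)

text \<open>Intersecting the atom with \<open>A\<close> gives a nonempty member of the algebra,
  hence the whole atom.\<close>

lemma atom_in_generator:
  assumes G: "\<And>A. A \<in> G \<Longrightarrow> A \<subseteq> V" and U: "U \<in> atoms (gen_algebra V G)"
    and "A \<in> G" "x \<in> A" "x \<in> U" "y \<in> U"
  shows "y \<in> A"
proof -
  have "A \<in> gen_algebra V G" using \<open>A \<in> G\<close> by (rule gen_algebra.gen)
  moreover have "U \<in> gen_algebra V G" using U by (simp add: atoms_def)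
  ultimately have "U \<inter> A \<in> gen_algebra V G"
    by (intro gen_algebra_Int gen_algebra_subset[OF G])
  then have "U \<inter> A = U" using U assms by (auto simp: atoms_def)
  then show ?thesis using \<open>y \<in> U\<close> by blast
qed

section \<open>Minimal forests: exchange property and atoms\<close>

lemma opt_forest_facts:
  assumes "finite V" "E \<subseteq> V \<times> V" "F \<in> opt_forests V E w k"
  shows "F \<subseteq> V \<times> V" "is_forest F" "card (roots V F) = k" "finite F" "phi V E w k = ereal (weight w F)"
proof -
  show F: "F \<subseteq> V \<times> V" "is_forest F" and "phi V E w k = ereal (weight w F)"
    using assms by (auto simp: opt_forests_def sforests_def)
  show "card (roots V F) = k"
    using card_trees[OF assms(1) F] assms(3) by (auto simp: opt_forests_def sforests_def)
  show "finite F" using F(1) assms(1) by (meson finite_SigmaI finite_subset)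
qed

lemma weight_swap:
  assumes "finite F" "finite H"
  shows "weight w (swap X H F) + weight w (swap X F H) = weight w F + weight w H"
proof -
  define g where "g = (\<lambda>(u, v). w u v)"
  have split: "sum g A = sum g {(x, y) \<in> A. x \<in> X} + sum g {(x, y) \<in> A. x \<notin> X}" if "finite A" for A
  proof -
    have "A = {(x, y) \<in> A. x \<in> X} \<union> {(x, y) \<in> A. x \<notin> X}" by auto
    moreover have "finite {(x, y) \<in> A. x \<in> X}" "finite {(x, y) \<in> A. x \<notin> X}"
      using that by (auto intro: finite_subset[rotated])
    ultimately show ?thesis using sum.union_disjoint[of "{(x, y) \<in> A. x \<in> X}" "{(x, y) \<in> A. x \<notin> X}" g]
      by fastforce
  qed
  have mix: "sum g (swap X A B) = sum g {(x, y) \<in> A. x \<in> X} + sum g {(x, y) \<in> B. x \<notin> X}"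
    if "finite A" "finite B" for A B
    unfolding swap_def using that by (intro sum.union_disjoint) (auto intro: finite_subset[rotated])
  show ?thesis
    using split[OF assms(1)] split[OF assms(2)] mix[OF assms] mix[OF assms(2,1)]
    by (simp add: weight_def g_def)
qed

lemma card_roots_swap:
  assumes "finite V"
  shows "card (roots V (swap X H F)) + card (roots V (swap X F H)) = card (roots V F) + card (roots V H)"
proof -
  have fin: "finite (roots V A)" for A using assms by (simp add: roots_def)
  have "card (roots V (swap X A B)) = card (roots V B - X) + card (roots V A \<inter> X)" for A B
    unfolding roots_swap using fin by (intro card_Un_disjoint) auto
  moreover have "card (roots V A) = card (roots V A - X) + card (roots V A \<inter> X)" for A
    using card_Int_Diff[OF fin, of A X] by simp
  ultimately show ?thesis by simp
qed

text \<open>A nonempty \<open>V\<close> forces a root, so the infinite value of \<open>phi\<close>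
  at \<open>0\<close> is never met and the infimum gives the bound.\<close>

lemma phi_le_weight:
  assumes "finite V" "E \<subseteq> V \<times> V" "V \<noteq> {}" "F \<subseteq> E" "is_forest F"
  shows "phi V E w (card (roots V F)) \<le> ereal (weight w F)"
proof -
  have FV: "F \<subseteq> V \<times> V" using assms by blast
  obtain r where "r \<in> roots V F" using root_exists[OF assms(1) FV assms(5)] assms(3) by blast
  moreover have "finite (roots V F)" using assms(1) by (simp add: roots_def)
  ultimately have "card (roots V F) \<noteq> 0" by auto
  moreover have "F \<in> sforests V E (card (roots V F))"
    using assms card_trees[OF assms(1) FV assms(5)] by (simp add: sforests_def)
  ultimately show ?thesis by (auto simp: phi_def intro: INF_lower)
qed

text \<open>An exchanged pair keeps total weight and total number of roots. With
  \<open>k - 1\<close> and \<open>k + 1\<close> roots it would violate the strict inequality; with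
  \<open>k\<close> roots each, both weights are at least the minimum, hence equal to it.\<close>

lemma opt_forests_exchange_family:
  assumes "finite V" and E: "E \<subseteq> V \<times> V" and "1 \<le> k"
    and convex: "phi V E w (k - 1) - phi V E w k > phi V E w k - phi V E w (k + 1)"
  shows "exchange_family V (opt_forests V E w k) k"
proof
  note facts = opt_forest_facts[OF assms(1,2)]
  have swap: "swap X H F \<subseteq> E" "is_forest (swap X H F)"
    if "F \<in> opt_forests V E w k" "H \<in> opt_forests V E w k" "acyclic (swap X H F)" for F H X
  proof -
    show "swap X H F \<subseteq> E" using that by (auto simp: swap_iff opt_forests_def sforests_def split: if_splits)
    show "is_forest (swap X H F)"
      using that facts(2)[OF that(1)] facts(2)[OF that(2)] single_valued_swap[of F H X]
      by (simp add: is_forest_iff)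
  qed
  show "Suc (card (roots V (swap X H F))) \<noteq> k" and
    "card (roots V (swap X H F)) = k \<Longrightarrow> swap X H F \<in> opt_forests V E w k"
    if FH: "F \<in> opt_forests V E w k" "H \<in> opt_forests V E w k"
      and ac: "acyclic (swap X H F)" "acyclic (swap X F H)" for F H X
  proof -
    have "V \<noteq> {}" using facts(3)[OF FH(1)] \<open>1 \<le> k\<close> by (auto simp: roots_def)
    note le = phi_le_weight[OF assms(1) E this, of _ w]
    note S1 = swap[OF FH ac(1)] and S2 = swap[OF FH(2,1) ac(2)]
    define a b c where "a = weight w (swap X H F)" and "b = weight w (swap X F H)" and "c = weight w F"
    have c: "phi V E w k = ereal c" "weight w H = c"
      using facts(5)[OF FH(1)] facts(5)[OF FH(2)] by (simp_all add: c_def)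
    have ab: "a + b = 2 * c"
      using weight_swap[OF facts(4)[OF FH(1)] facts(4)[OF FH(2)]] c by (simp add: a_def b_def c_def)
    have cards: "card (roots V (swap X H F)) + card (roots V (swap X F H)) = 2 * k"
      using card_roots_swap[OF assms(1)] facts(3) FH by simp
    show "Suc (card (roots V (swap X H F))) \<noteq> k"
    proof
      assume "Suc (card (roots V (swap X H F))) = k"
      then have "card (roots V (swap X H F)) = k - 1" "card (roots V (swap X F H)) = k + 1"
        using cards by auto
      then have "phi V E w (k - 1) \<le> ereal a" "phi V E w (k + 1) \<le> ereal b"
        using le[OF S1] le[OF S2] by (simp_all add: a_def b_def)
      \<comment> \<open>Differences are compared in \<open>ereal\<close>, the form of the convexity
        hypothesis; only \<open>phi\<close> at \<open>k\<close> has been identified with a real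
        number.\<close>
      then have "phi V E w (k - 1) - ereal c \<le> ereal a - ereal c"
        and "ereal c - ereal b \<le> ereal c - phi V E w (k + 1)"
        by (simp_all only: ereal_minus_mono order_refl)
      moreover have "ereal a - ereal c = ereal c - ereal b" using ab by simp
      ultimately show False using convex unfolding c by (metis leD order_trans)
    qed
    assume k: "card (roots V (swap X H F)) = k"
    then have "c \<le> a" "c \<le> b" using le[OF S1] le[OF S2] cards c by (simp_all add: a_def b_def)
    then have "a = c" using ab by simp
    then show "swap X H F \<in> opt_forests V E w k"
      using S1 k c card_trees[OF assms(1) _ S1(2)] E by (auto simp: opt_forests_def sforests_def a_def)
  qed
qed (use assms(1) opt_forest_facts[OF assms(1,2)] in auto)

text \<open>A tree of a minimal forest that meets an atom contains it; conversely, vertices sharing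
  all such trees are separated by no set of the algebra. Atoms are thereby expressed through
  \<open>linked\<close>.\<close>

lemma atom_iff_linked:
  assumes "finite V" "E \<subseteq> V \<times> V" and U: "U \<in> atoms (algebra_k V E w k)" and "x \<in> U" "y \<in> V"
  shows "y \<in> U \<longleftrightarrow> (\<forall>F\<in>opt_forests V E w k. linked V F x y)"
proof -
  define G where "G = (\<Union>F \<in> opt_forests V E w k. trees V F)"
  have U': "U \<in> atoms (gen_algebra V G)" using U by (simp add: G_def algebra_k_def)
  note facts = opt_forest_facts[OF assms(1,2)]
  have trees: "trees V F = (\<lambda>x. {y \<in> V. linked V F x y}) ` V" if "F \<in> opt_forests V E w k" for F
    by (rule trees_eq_linked[OF assms(1) facts(1)[OF that] facts(2)[OF that]])
  have GV: "A \<subseteq> V" if "A \<in> G" for A using that trees by (auto simp: G_def)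
  have xV: "x \<in> V" using gen_algebra_subset[OF GV] U' \<open>x \<in> U\<close> by (auto simp: atoms_def)
  show ?thesis
  proof (intro iffI ballI)
    fix F assume "y \<in> U" and F: "F \<in> opt_forests V E w k"
    let ?A = "{z \<in> V. linked V F x z}"
    have "?A \<in> G" using trees[OF F] F xV by (auto simp: G_def)
    moreover have "x \<in> ?A"
      using root_exists[OF assms(1) facts(1,2)[OF F] xV] xV by (auto simp: linked_def)
    ultimately show "linked V F x y"
      using atom_in_generator[OF GV U' _ _ \<open>x \<in> U\<close> \<open>y \<in> U\<close>] by blast
  next
    assume l: "\<forall>F\<in>opt_forests V E w k. linked V F x y"
    have "x \<in> A \<longleftrightarrow> y \<in> A" if AG: "A \<in> G" for A
    proof -
      obtain F z where F: "F \<in> opt_forests V E w k" and A: "A = {y \<in> V. linked V F z y}"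
        using AG trees by (auto simp: G_def)
      have "single_valued F" using facts(2)[OF F] by (simp add: is_forest_iff)
      moreover have "linked V F x y" using l F by blast
      ultimately have "linked V F z x \<longleftrightarrow> linked V F z y"
        using linked_root unfolding linked_def by metis
      then show ?thesis using A xV \<open>y \<in> V\<close> by simp
    qed
    then show "y \<in> U"
      using gen_algebra_saturated[of G x y V U] xV \<open>y \<in> V\<close> U' \<open>x \<in> U\<close> by (auto simp: atoms_def)
  qed
qed

theorem theorem2:
  fixes V :: "'a set" and E :: "('a \<times> 'a) set" and w :: "'a \<Rightarrow> 'a \<Rightarrow> real" and k :: nat
  assumes "finite V" and "E \<subseteq> V \<times> V"
    and "sforests V E 1 \<noteq> {}"
    and "1 \<le> k" and "k \<le> card V - 1"
    and "phi V E w (k - 1) - phi V E w k > phi V E w k - phi V E w (k + 1)"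
    and "F \<in> opt_forests V E w k"
    and "U \<in> atoms (algebra_k V E w k)" and "\<not> labeled V E w k U"
    and "M \<in> atoms (algebra_k V E w k)" and "labeled V E w k M"
    and "a \<in> F" and "leaves U a" and "snd a \<in> M"
  shows "\<forall>b \<in> F. leaves U b \<longrightarrow> b = a"
proof (intro ballI impI, rule ccontr)
  interpret exchange_family V "opt_forests V E w k" k
    using opt_forests_exchange_family assms by blast
  fix b assume "b \<in> F" "leaves U b" "b \<noteq> a"
  obtain u m where a: "a = (u, m)" by fastforce
  obtain v n where b: "b = (v, n)" by fastforce
  have um: "(u, m) \<in> F" "u \<in> U" "m \<in> M" and vn: "(v, n) \<in> F" "v \<in> U" "n \<notin> U"
    using assms \<open>b \<in> F\<close> \<open>leaves U b\<close> a b by (auto simp: leaves_def)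
  have "u \<noteq> v" using \<open>b \<noteq> a\<close> um vn sv[OF assms(7)] a b by (auto dest: single_valuedD)
  have V: "m \<in> V" "v \<in> V" "n \<in> V" using um vn arcs[OF assms(7)] by auto
  note atom = atom_iff_linked[OF assms(1,2)]
  obtain F0 r0 where F0: "F0 \<in> opt_forests V E w k" "r0 \<in> roots V F0" "r0 \<in> M"
    using assms(11) by (auto simp: labeled_def)
  have "linked V H u v" if "H \<in> opt_forests V E w k" for H
    using atom[OF assms(8) um(2) V(2)] vn that by blast
  moreover have "linked V H m r0" if "H \<in> opt_forests V E w k" for H
    using atom[OF assms(10) um(3)] F0 roots_V that by blast
  \<comment> \<open>\<open>n\<close> lies outside the atom \<open>U\<close>, so some minimal forest
    separates it from \<open>u\<close>.\<close>
  moreover obtain H where "H \<in> opt_forests V E w k" "\<not> linked V H u n"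
    using atom[OF assms(8) um(2) V(3)] vn by blast
  ultimately show False
    using exit_to_labeled_is_unique[OF assms(7) um(1) vn(1) \<open>u \<noteq> v\<close>] F0 by blast
qed

end
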